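(* Let $P_3(n)$ and $\widetilde P_3(n)$ be the numbers of $3$-dimensional partitions and of punctual $3$-dimensional partitions of $n$, respectively. Then, as formal power series in $q$, $$\frac{\sum_{n=0}^{+\infty}\widetilde P_3(n)\, q^n}{\sum_{n=0}^{+\infty} P_3(n)\, q^n} = \frac{1}{1-q}.$$
   Context: A $3$-dimensional partition (respectively, a punctual $3$-dimensional partition) of $n\ge 0$ is an array $(n_{i_1,i_2})$ of nonnegative integers indexed by the pairs $(i_1,i_2)\in(\mathbb Z_{\ge 0})^{2}$ (respectively, by the pairs $(i_1,i_2)\in(\mathbb Z_{\ge 0})^{2}-\{(0,0)\}$) such that $\sum_{i_1,i_2} n_{i_1,i_2}=n$ and $n_{i_1,i_2}\ge n_{j_1,j_2}$ whenever $i_1\le j_1$ and $i_2\le j_2$. *)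

theory Defs
  imports "HOL-Library.FuncSet" "HOL-Computational_Algebra.Formal_Power_Series"
begin

text \<open>
  Arrays of nonnegative integers on an index set \<open>I\<close> of pairs are taken to be extensional functions
  (equal to \<open>undefined\<close> off \<open>I\<close>), so that distinct functions are distinct arrays. A family of
  nonnegative integers has a finite sum iff its support is finite, and its sum is then the sum
  over the support.
\<close>

definition array_partitions :: "(nat \<times> nat) set \<Rightarrow> nat \<Rightarrow> (nat \<times> nat \<Rightarrow> nat) set" where
  "array_partitions I n =
     {f \<in> I \<rightarrow>\<^sub>E UNIV.
        finite {i \<in> I. f i \<noteq> 0} \<and>
        (\<Sum>i | i \<in> I \<and> f i \<noteq> 0. f i) = n \<and>
        (\<forall>(i1, i2) \<in> I. \<forall>(j1, j2) \<in> I. i1 \<le> j1 \<and> i2 \<le> j2 \<longrightarrow> f (i1, i2) \<ge> f (j1, j2))}"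

definition partitions3 :: "nat \<Rightarrow> (nat \<times> nat \<Rightarrow> nat) set" where
  "partitions3 n = array_partitions UNIV n"

definition punctual_partitions3 :: "nat \<Rightarrow> (nat \<times> nat \<Rightarrow> nat) set" where
  "punctual_partitions3 n = array_partitions (UNIV - {(0, 0)}) n"

definition P3 :: "nat \<Rightarrow> nat" where
  "P3 n = card (partitions3 n)"

definition punctual_P3 :: "nat \<Rightarrow> nat" where
  "punctual_P3 n = card (punctual_partitions3 n)"

text \<open>The sets counted by \<open>card\<close> are finite.\<close>

lemma finite_array_partitions:
  assumes I: "\<And>i1 i2 j1 j2. (i1, i2) \<in> I \<Longrightarrow> i1 \<le> j1 \<Longrightarrow> i2 \<le> j2 \<Longrightarrow> (j1, j2) \<in> I"
    and ax: "(1, 0) \<in> I" "(0, 1) \<in> I"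
  shows "finite (array_partitions I n)"
proof -
  define B where "B = {..n + 1} \<times> {..n + 1}"
  define ext where "ext = (\<lambda>g i. if i \<in> I then if i \<in> B then g i else 0 else undefined :: nat)"
  have "array_partitions I n \<subseteq> ext ` (B \<rightarrow>\<^sub>E {..n})"
  proof
    fix f assume "f \<in> array_partitions I n"
    then have f: "f \<in> extensional I" and fin: "finite {i \<in> I. f i \<noteq> 0}"
      and sm: "(\<Sum>i | i \<in> I \<and> f i \<noteq> 0. f i) = n"
      and mono: "\<And>i1 i2 j1 j2. (i1, i2) \<in> I \<Longrightarrow> (j1, j2) \<in> I \<Longrightarrow> i1 \<le> j1 \<Longrightarrow> i2 \<le> j2 \<Longrightarrow>
        f (j1, j2) \<le> f (i1, i2)"
      by (auto simp: array_partitions_def PiE_def)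
    have le: "f i \<le> n" if "i \<in> I" for i
    proof (cases "f i = 0")
      case False
      then show ?thesis using member_le_sum[of i "{i \<in> I. f i \<noteq> 0}" f] that fin sm by auto
    qed simp
    have card_le: "card {i \<in> I. f i \<noteq> 0} \<le> n"
    proof -
      have "card {i \<in> I. f i \<noteq> 0} = (\<Sum>i | i \<in> I \<and> f i \<noteq> 0. 1)" by simp
      also have "\<dots> \<le> (\<Sum>i | i \<in> I \<and> f i \<noteq> 0. f i)" by (rule sum_mono) auto
      finally show ?thesis using sm by simp
    qed
    have zero: "f (a, b) = 0" if ab: "(a, b) \<in> I" "(a, b) \<notin> B" for a b
    proof (rule ccontr)
      assume nz: "f (a, b) \<noteq> 0"
      have "\<exists>S. S \<subseteq> {i \<in> I. f i \<noteq> 0} \<and> card S > n"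
      proof (cases "a > n + 1")
        case True
        have "(\<lambda>k. (k, b)) ` {1..a} \<subseteq> {i \<in> I. f i \<noteq> 0}"
        proof clarify
          fix k assume k: "k \<in> {1..a}"
          have "(k, b) \<in> I" using I[OF ax(1), of k b] k by auto
          with mono[of k b a b] ab nz k show "(k, b) \<in> I \<and> f (k, b) \<noteq> 0" by auto
        qed
        moreover have "card ((\<lambda>k. (k, b)) ` {1..a}) = a" by (subst card_image) (auto simp: inj_on_def)
        ultimately show ?thesis using True by (intro exI[of _ "(\<lambda>k. (k, b)) ` {1..a}"]) auto
      next
        case False
        then have b: "b > n + 1" using ab by (auto simp: B_def)
        have "(\<lambda>k. (a, k)) ` {1..b} \<subseteq> {i \<in> I. f i \<noteq> 0}"
        proof clarify
          fix k assume k: "k \<in> {1..b}"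
          have "(a, k) \<in> I" using I[OF ax(2), of a k] k by auto
          with mono[of a k a b] ab nz k show "(a, k) \<in> I \<and> f (a, k) \<noteq> 0" by auto
        qed
        moreover have "card ((\<lambda>k. (a, k)) ` {1..b}) = b" by (subst card_image) (auto simp: inj_on_def)
        ultimately show ?thesis using b by (intro exI[of _ "(\<lambda>k. (a, k)) ` {1..b}"]) auto
      qed
      then show False using card_mono[OF fin] card_le by (meson le_trans not_le)
    qed
    define g where "g = restrict (\<lambda>i. if i \<in> I then f i else 0) B"
    have "g \<in> B \<rightarrow>\<^sub>E {..n}" using le by (auto simp: g_def)
    moreover have "f = ext g"
    proof
      fix i show "f i = ext g i"
        using zero[of "fst i" "snd i"] f by (cases i) (auto simp: ext_def g_def extensional_def)
    qed
    ultimately show "f \<in> ext ` (B \<rightarrow>\<^sub>E {..n})" by blast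
  qed
  moreover have "finite (B \<rightarrow>\<^sub>E {..n})" by (intro finite_PiE) (auto simp: B_def)
  ultimately show ?thesis by (meson finite_imageI finite_subset)
qed

lemma finite_partitions3: "finite (partitions3 n)"
  unfolding partitions3_def by (rule finite_array_partitions) auto

lemma finite_punctual_partitions3: "finite (punctual_partitions3 n)"
  unfolding punctual_partitions3_def by (rule finite_array_partitions) auto

end

theory Submission
  imports Defs "HOL-Combinatorics.Transposition"
begin

text \<open>
  Rotated by a half turn, the (punctual) partitions of \<open>n \<le> N\<close> are the reverse plane partitions of \<open>n\<close>
  on an \<open>(N + 1) \<times> (N + 1)\<close> square (without its last corner). The generating function of the reverse
  plane partitions of a Young diagram is the product of \<open>1 / (1 - q ^ h)\<close> over its hook lengths \<open>h\<close>;
  removing the last corner of the square lowers by one the other hook lengths in the last row and in the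
  last column, so that the quotient of the two generating functions is
  \<open>(1 - q ^ (N + 1))\<^sup>2 / (1 - q)\<close>, and \<open>N\<close> is arbitrary.

  The hook formula follows from the piecewise-linear form of the Robinson-Schensted-Knuth
  correspondence: the diagram grows corner by corner, and each new corner toggles the entries on its
  diagonal. The induction needs arbitrary weights on the diagonals. If the diagonal \<open>j - i = k\<close> has
  weight \<open>E (k + 1) - E k\<close>, then adding a corner on the diagonal \<open>c\<close> exchanges \<open>E c\<close> and
  \<open>E (c + 1)\<close>, both for reverse plane partitions and for hooks.
\<close>

section \<open>Reverse plane partitions and toggles\<close>

definition downset :: "(nat \<times> nat) set \<Rightarrow> bool" where
  "downset S \<longleftrightarrow> (\<forall>i j i' j'. (i', j') \<in> S \<longrightarrow> i \<le> i' \<longrightarrow> j \<le> j' \<longrightarrow> (i, j) \<in> S)"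

text \<open>Since entries off \<open>S\<close> are zero, a filling of a diagram is also a filling of
  any larger one, and a corner is removed by writing 0 there.\<close>

definition fillings :: "'a set \<Rightarrow> ('a \<Rightarrow> nat) set" where
  "fillings S = {f. \<forall>u. u \<notin> S \<longrightarrow> f u = 0}"

definition rpp :: "(nat \<times> nat) set \<Rightarrow> (nat \<times> nat \<Rightarrow> nat) set" where
  "rpp S = {f \<in> fillings S.
     (\<forall>i j. (Suc i, j) \<in> S \<longrightarrow> f (i, j) \<le> f (Suc i, j)) \<and>
     (\<forall>i j. (i, Suc j) \<in> S \<longrightarrow> f (i, j) \<le> f (i, Suc j))}"

text \<open>Off the board the value is 0, the least possible entry, so lower bounds by north and
  west neighbours also hold in the first row and column.\<close>

fun north :: "(nat \<times> nat \<Rightarrow> nat) \<Rightarrow> nat \<times> nat \<Rightarrow> nat" where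
  "north f (0, j) = 0"
| "north f (Suc i, j) = f (i, j)"

fun west :: "(nat \<times> nat \<Rightarrow> nat) \<Rightarrow> nat \<times> nat \<Rightarrow> nat" where
  "west f (i, 0) = 0"
| "west f (i, Suc j) = f (i, j)"

fun south :: "(nat \<times> nat \<Rightarrow> nat) \<Rightarrow> nat \<times> nat \<Rightarrow> nat" where
  "south f (i, j) = f (Suc i, j)"

fun east :: "(nat \<times> nat \<Rightarrow> nat) \<Rightarrow> nat \<times> nat \<Rightarrow> nat" where
  "east f (i, j) = f (i, Suc j)"

lemma north_pos: "0 < north f (i, j) \<Longrightarrow> 0 < i"
  by (cases i) auto

lemma west_pos: "0 < west f (i, j) \<Longrightarrow> 0 < j"
  by (cases j) auto

lemma north_eq: "0 < i \<Longrightarrow> north f (i, j) = f (i - 1, j)"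
  by (cases i) auto

lemma west_eq: "0 < j \<Longrightarrow> west f (i, j) = f (i, j - 1)"
  by (cases j) auto

lemma max_add_min: "max x y + min x y = x + (y :: nat)"
  by (simp add: max_def min_def)

text \<open>The equation \<open>i + b = j + a\<close> is \<open>j - i = b - a\<close> without
  truncated subtraction; with \<open>i < a\<close> it forces \<open>j < b\<close>.\<close>

definition diag_below :: "nat \<Rightarrow> nat \<Rightarrow> (nat \<times> nat) set" where
  "diag_below a b = {(i, j). i < a \<and> i + b = j + a}"

text \<open>The piecewise-linear toggle: \<open>f u\<close> is reflected in the interval allowed by
  its four neighbours. On reverse plane partitions \<open>diag_bounds\<close> keeps the subtraction
  from truncating.\<close>

definition toggle :: "nat \<Rightarrow> nat \<Rightarrow> (nat \<times> nat \<Rightarrow> nat) \<Rightarrow> nat \<times> nat \<Rightarrow> nat" where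
  "toggle a b f u =
     (if u \<in> diag_below a b
      then max (north f u) (west f u) + min (south f u) (east f u) - f u else f u)"

text \<open>\<open>t\<close> is the excess over the least value allowed at the new corner, so it
  ranges over all of \<open>nat\<close>.\<close>

definition add_corner :: "nat \<Rightarrow> nat \<Rightarrow> nat \<Rightarrow> (nat \<times> nat \<Rightarrow> nat) \<Rightarrow> nat \<times> nat \<Rightarrow> nat" where
  "add_corner a b t f = f((a, b) := max (north f (a, b)) (west f (a, b)) + t)"

section \<open>Adding a corner to a Young diagram\<close>

locale corner =
  fixes S :: "(nat \<times> nat) set" and a b :: nat
  assumes downset: "downset S" and downset': "downset (insert (a, b) S)"
    and notin: "(a, b) \<notin> S" and fin: "finite S"
begin

lemma below: "i \<le> a \<Longrightarrow> j \<le> b \<Longrightarrow> (i, j) \<noteq> (a, b) \<Longrightarrow> (i, j) \<in> S"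
  using downset' unfolding downset_def by blast

lemma not_above: "a \<le> i \<Longrightarrow> b \<le> j \<Longrightarrow> (i, j) \<notin> S"
  using downset notin unfolding downset_def by blast

lemma diag_mem_iff: "i + b = j + a \<Longrightarrow> (i, j) \<in> S \<longleftrightarrow> i < a"
  using below[of i j] not_above[of i j] by (cases "i < a") auto

lemma upper_diag_mem_iff: "Suc i + b = j + a \<Longrightarrow> (i, j) \<in> S \<longleftrightarrow> i < a"
  using below[of i j] not_above[of i j] by (cases "i < a") auto

lemma lower_diag_mem_iff: "i + b = Suc j + a \<Longrightarrow> (i, j) \<in> S \<longleftrightarrow> j < b"
  using below[of i j] not_above[of i j] by (cases "j < b") auto

lemma diag_bounds:
  assumes f: "f \<in> rpp (insert (a, b) S)" and u: "u \<in> diag_below a b"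
  shows "max (north f u) (west f u) \<le> f u" "f u \<le> min (south f u) (east f u)"
proof -
  obtain i j where u': "u = (i, j)" "i < a" "j < b" "i + b = j + a"
    using u by (auto simp: diag_below_def)
  have mem: "(i, j) \<in> S" "(Suc i, j) \<in> S" "(i, Suc j) \<in> S"
    using below u' by auto
  show "max (north f u) (west f u) \<le> f u"
    using f mem u' by (cases i; cases j) (auto simp: rpp_def)
  show "f u \<le> min (south f u) (east f u)"
    using f mem u' by (auto simp: rpp_def)
qed

text \<open>Neighbouring cells lie on neighbouring diagonals, so the toggles along one diagonal do
  not interact and can be made at once.\<close>

lemma toggle_neighbours:
  assumes "u \<in> insert (a, b) (diag_below a b)"
  shows "north (toggle a b f) u = north f u" "west (toggle a b f) u = west f u"
    "south (toggle a b f) u = south f u" "east (toggle a b f) u = east f u"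
proof -
  obtain i j where u: "u = (i, j)" "i + b = j + a"
    using assms by (auto simp: diag_below_def)
  show "north (toggle a b f) u = north f u" "west (toggle a b f) u = west f u"
    "south (toggle a b f) u = south f u" "east (toggle a b f) u = east f u"
    using u by (cases i; cases j; auto simp: toggle_def diag_below_def)+
qed

lemma toggle_bounds:
  assumes f: "f \<in> rpp (insert (a, b) S)" and u: "u \<in> diag_below a b"
  shows "max (north f u) (west f u) \<le> toggle a b f u" 
        "toggle a b f u \<le> min (south f u) (east f u)"
  using diag_bounds[OF assms] u by (auto simp: toggle_def)

text \<open>Each inequality joins cells of consecutive diagonals, hence involves at most one toggled
  cell, and that cell stays within the bounds set by its unchanged neighbours.\<close>

lemma toggle_rpp:
  assumes f: "f \<in> rpp (insert (a, b) S)"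
  shows "toggle a b f \<in> rpp (insert (a, b) S)"
proof -
  let ?g = "toggle a b f"
  have D: "u \<in> S" if "u \<in> diag_below a b" for u
    using that below by (auto simp: diag_below_def)
  have off: "?g \<in> fillings (insert (a, b) S)"
    using f D by (auto simp: fillings_def rpp_def toggle_def)
  have 1: "?g (i, j) \<le> ?g (Suc i, j)" if m: "(Suc i, j) \<in> insert (a, b) S" for i j
  proof -
    have le: "f (i, j) \<le> f (Suc i, j)" using f m by (auto simp: rpp_def)
    consider "(i, j) \<in> diag_below a b" | "(Suc i, j) \<in> diag_below a b"
      | "(i, j) \<notin> diag_below a b" "(Suc i, j) \<notin> diag_below a b" by blast
    then show ?thesis
    proof cases
      case 1
      then have "?g (Suc i, j) = f (Suc i, j)" by (auto simp: toggle_def diag_below_def)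
      then show ?thesis using toggle_bounds(2)[OF f 1] by simp
    next
      case 2
      then have "?g (i, j) = f (i, j)" by (auto simp: toggle_def diag_below_def)
      then show ?thesis using toggle_bounds(1)[OF f 2] by simp
    next
      case 3
      then show ?thesis using le by (simp add: toggle_def)
    qed
  qed
  have 2: "?g (i, j) \<le> ?g (i, Suc j)" if m: "(i, Suc j) \<in> insert (a, b) S" for i j
  proof -
    have le: "f (i, j) \<le> f (i, Suc j)" using f m by (auto simp: rpp_def)
    consider "(i, j) \<in> diag_below a b" | "(i, Suc j) \<in> diag_below a b"
      | "(i, j) \<notin> diag_below a b" "(i, Suc j) \<notin> diag_below a b" by blast
    then show ?thesis
    proof cases
      case 1
      then have "?g (i, Suc j) = f (i, Suc j)" by (auto simp: toggle_def diag_below_def)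
      then show ?thesis using toggle_bounds(2)[OF f 1] by simp
    next
      case 2
      then have "?g (i, j) = f (i, j)" by (auto simp: toggle_def diag_below_def)
      then show ?thesis using toggle_bounds(1)[OF f 2] by simp
    next
      case 3
      then show ?thesis using le by (simp add: toggle_def)
    qed
  qed
  show ?thesis using off 1 2 by (auto simp: rpp_def)
qed

lemma toggle_toggle:
  assumes f: "f \<in> rpp (insert (a, b) S)"
  shows "toggle a b (toggle a b f) = f"
proof
  fix u show "toggle a b (toggle a b f) u = f u"
    using toggle_neighbours[of u f] diag_bounds[OF f, of u]
    by (cases "u \<in> diag_below a b") (auto simp: toggle_def[of a b _ u])
qed

lemma bij_toggle:
  "bij_betw (toggle a b) (rpp (insert (a, b) S)) (rpp (insert (a, b) S))"
  by (rule bij_betw_byWitness[where f' = "toggle a b"]) (auto simp: toggle_toggle toggle_rpp)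

lemma add_corner_rpp:
  assumes f: "f \<in> rpp S"
  shows "add_corner a b t f \<in> rpp (insert (a, b) S)"
proof -
  have "(Suc a, b) \<notin> S" "(a, Suc b) \<notin> S" using not_above by auto
  then show ?thesis using f notin
    by (auto simp: rpp_def fillings_def add_corner_def)
qed

lemma remove_corner_rpp:
  assumes f: "f \<in> rpp (insert (a, b) S)"
  shows "f((a, b) := 0) \<in> rpp S"
proof -
  have "(Suc a, b) \<notin> S" "(a, Suc b) \<notin> S" using not_above by auto
  then show ?thesis using f notin by (auto simp: rpp_def fillings_def)
qed

lemma corner_neighbours:
  "north (f((a, b) := v)) (a, b) = north f (a, b)" "west (f((a, b) := v)) (a, b) = west f (a, b)"
  by (cases a; cases b; simp)+

lemma corner_ge:
  assumes f: "f \<in> rpp (insert (a, b) S)"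
  shows "max (north f (a, b)) (west f (a, b)) \<le> f (a, b)"
  using f by (cases a; cases b) (auto simp: rpp_def)

text \<open>No cell of \<open>S\<close> lies weakly south-east of \<open>(a, b)\<close>, so the
  corner entry is bounded only from below, by its north and west neighbours.\<close>

lemma bij_add_corner:
  "bij_betw (\<lambda>(t, f). add_corner a b t f) (UNIV \<times> rpp S) (rpp (insert (a, b) S))"
proof (rule bij_betw_byWitness[where f' =
      "\<lambda>f. (f (a, b) - max (north f (a, b)) (west f (a, b)), f((a, b) := 0))"])
  show "\<forall>x\<in>UNIV \<times> rpp S.
       (\<lambda>f. (f (a, b) - max (north f (a, b)) (west f (a, b)), f((a, b) := 0)))
        (case x of (t, f) \<Rightarrow> add_corner a b t f) = x"
    using notin by (auto simp: add_corner_def corner_neighbours rpp_def fillings_def fun_eq_iff)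
  show "\<forall>f\<in>rpp (insert (a, b) S).
       (case (f (a, b) - max (north f (a, b)) (west f (a, b)), f((a, b) := 0)) of
        (t, f) \<Rightarrow> add_corner a b t f) = f"
    using corner_ge by (auto simp: add_corner_def corner_neighbours fun_eq_iff)
qed (auto simp: add_corner_rpp remove_corner_rpp)

lemma finite_diag: "finite (diag_below a b)"
  by (rule finite_subset[of _ "{..a} \<times> {..b}"]) (auto simp: diag_below_def)

lemma corner_notin_diag: "(a, b) \<notin> diag_below a b"
  by (auto simp: diag_below_def)

text \<open>The north neighbours run through the diagonal \<open>j - i = b - a + 1\<close>;
  \<open>upper_diag_mem_iff\<close> shows that all of its cells in \<open>S\<close> arise, and a
  cell in row 0 contributes 0.\<close>

lemma sum_north:
  "(\<Sum>u \<in> insert (a, b) (diag_below a b). north f u) = (\<Sum>(i, j) | (i, j) \<in> S \<and> Suc i + b = j + a. f (i, j))"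
proof -
  have "(\<Sum>u \<in> insert (a, b) (diag_below a b). north f u)
      = (\<Sum>u \<in> {u \<in> insert (a, b) (diag_below a b). fst u > 0}. north f u)"
    by (rule sum.mono_neutral_right) (auto simp: finite_diag dest!: north_pos west_pos)
  also have "\<dots> = (\<Sum>(i, j) | (i, j) \<in> S \<and> Suc i + b = j + a. f (i, j))"
    by (rule sum.reindex_bij_witness[where i = "\<lambda>(i, j). (Suc i, j)" and j = "\<lambda>(i, j). (i - 1, j)"])
       (auto simp: diag_below_def upper_diag_mem_iff north_eq)
  finally show ?thesis .
qed

lemma sum_west:
  "(\<Sum>u \<in> insert (a, b) (diag_below a b). west f u) = (\<Sum>(i, j) | (i, j) \<in> S \<and> i + b = Suc j + a. f (i, j))"
proof -
  have "(\<Sum>u \<in> insert (a, b) (diag_below a b). west f u)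
      = (\<Sum>u \<in> {u \<in> insert (a, b) (diag_below a b). snd u > 0}. west f u)"
    by (rule sum.mono_neutral_right) (auto simp: finite_diag dest!: north_pos west_pos)
  also have "\<dots> = (\<Sum>(i, j) | (i, j) \<in> S \<and> i + b = Suc j + a. f (i, j))"
    by (rule sum.reindex_bij_witness[where i = "\<lambda>(i, j). (i, Suc j)" and j = "\<lambda>(i, j). (i, j - 1)"])
       (auto simp: diag_below_def lower_diag_mem_iff west_eq)
  finally show ?thesis .
qed

text \<open>The south and east neighbours of \<open>(i, j)\<close> are the west and north neighbours
  of \<open>(i + 1, j + 1)\<close>. The first cell of the diagonal lies on the border, where the
  minimum is 0.\<close>

lemma sum_min:
  "(\<Sum>u \<in> diag_below a b. min (south f u) (east f u))
    = (\<Sum>u \<in> insert (a, b) (diag_below a b). min (north f u) (west f u))"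
proof -
  have "(\<Sum>u \<in> insert (a, b) (diag_below a b). min (north f u) (west f u))
      = (\<Sum>u \<in> {u \<in> insert (a, b) (diag_below a b). fst u > 0 \<and> snd u > 0}. min (north f u) (west f u))"
    by (rule sum.mono_neutral_right) (auto simp: finite_diag dest!: north_pos west_pos)
  also have "\<dots> = (\<Sum>u \<in> diag_below a b. min (south f u) (east f u))"
    by (rule sum.reindex_bij_witness[where i = "\<lambda>(i, j). (Suc i, Suc j)" and j = "\<lambda>(i, j). (i - 1, j - 1)"])
       (auto simp: diag_below_def north_eq west_eq min.commute)
  finally show ?thesis by simp
qed


text \<open>Each toggle is only piecewise linear, but the diagonal sum changes linearly: after the
  shift of \<open>sum_min\<close>, every maximum meets the minimum of the same two entries, and
  \<open>max_add_min\<close> turns the pair into a sum.\<close>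

lemma toggle_add_corner_sum:
  assumes f: "f \<in> rpp S"
  shows "(\<Sum>u \<in> insert (a, b) (diag_below a b). toggle a b (add_corner a b t f) u) + (\<Sum>u \<in> diag_below a b. f u)
    = t + (\<Sum>(i, j) | (i, j) \<in> S \<and> Suc i + b = j + a. f (i, j))
        + (\<Sum>(i, j) | (i, j) \<in> S \<and> i + b = Suc j + a. f (i, j))"
proof -
  let ?D = "diag_below a b"
  let ?D' = "insert (a, b) ?D"
  define g where "g = add_corner a b t f"
  have g: "g \<in> rpp (insert (a, b) S)" unfolding g_def using add_corner_rpp[OF f] .
  have gf: "g u = f u" if "u \<noteq> (a, b)" for u using that by (simp add: g_def add_corner_def)
  have n: "north g u = north f u" "west g u = west f u" if "u \<in> ?D'" for u
    using that gf by (cases u; cases "fst u"; cases "snd u"; auto simp: diag_below_def)+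
  have tog: "toggle a b g u + f u = max (north f u) (west f u) + min (south g u) (east g u)"
    if "u \<in> ?D" for u
  proof -
    have "g u = f u" using that corner_notin_diag gf by metis
    then show ?thesis using that diag_bounds[OF g that] n[of u] by (auto simp: toggle_def max_def min_def)
  qed
  have se: "south g u = south f u" "east g u = east f u" if "u \<in> ?D" for u
    using that gf by (auto simp: diag_below_def)
  have tp: "toggle a b g (a, b) = max (north f (a, b)) (west f (a, b)) + t"
    using corner_notin_diag by (simp add: toggle_def g_def add_corner_def)
  have "(\<Sum>u \<in> ?D'. toggle a b g u) + (\<Sum>u \<in> ?D. f u)
      = max (north f (a, b)) (west f (a, b)) + t + (\<Sum>u \<in> ?D. toggle a b g u + f u)"
    using finite_diag corner_notin_diag by (simp add: tp sum.distrib)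
  also have "\<dots> = t + (\<Sum>u \<in> ?D'. max (north f u) (west f u)) + (\<Sum>u \<in> ?D. min (south f u) (east f u))"
    using finite_diag corner_notin_diag by (simp add: tog se sum.distrib)
  also have "\<dots> = t + (\<Sum>u \<in> ?D'. max (north f u) (west f u) + min (north f u) (west f u))"
    by (simp only: sum_min sum.distrib add.assoc)
  also have "\<dots> = t + (\<Sum>u \<in> ?D'. north f u + west f u)"
    by (simp only: max_add_min)
  finally show ?thesis
    by (simp only: sum.distrib sum_north sum_west g_def add.assoc)
qed

end

lemma sum_if_const_mult:
  fixes k :: "'a :: semiring_0"
  assumes "finite S"
  shows "(\<Sum>u \<in> S. if P u then k * F u else 0) = k * (\<Sum>u | u \<in> S \<and> P u. F u)"
  using assms by (simp add: sum.inter_filter sum_distrib_left if_distrib[of "(*) k"] cong: if_cong)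

section \<open>The weighted hook formula\<close>

definition stat :: "(int \<Rightarrow> int) \<Rightarrow> (nat \<times> nat) set \<Rightarrow> (nat \<times> nat \<Rightarrow> nat) \<Rightarrow> int" where
  "stat E S f = (\<Sum>(i, j) \<in> S. (E (int j - int i + 1) - E (int j - int i)) * int (f (i, j)))"

definition row_len :: "(nat \<times> nat) set \<Rightarrow> nat \<Rightarrow> nat" where
  "row_len S i = card {j. (i, j) \<in> S}"

definition col_len :: "(nat \<times> nat) set \<Rightarrow> nat \<Rightarrow> nat" where
  "col_len S j = card {i. (i, j) \<in> S}"

text \<open>
  The hook of \<open>(i, j)\<close> meets the diagonals from \<open>j + 1 - col_len S j\<close> to \<open>row_len S i - i - 1\<close>, and
  the sum of their weights telescopes.
\<close>
definition hook_stat :: "(int \<Rightarrow> int) \<Rightarrow> (nat \<times> nat) set \<Rightarrow> (nat \<times> nat \<Rightarrow> nat) \<Rightarrow> int" where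
  "hook_stat E S g = (\<Sum>(i, j) \<in> S.
     (E (int (row_len S i) - int i) - E (int j + 1 - int (col_len S j))) * int (g (i, j)))"

context corner
begin

text \<open>Exchanging \<open>E c\<close> and \<open>E (c + 1)\<close> negates the weight
  \<open>w c\<close> of the diagonal \<open>c\<close> and adds \<open>w c\<close> to the weights of
  both neighbouring diagonals. This matches \<open>toggle_add_corner_sum\<close>: the new diagonal
  sum is \<open>t\<close> plus the two neighbouring sums minus the old one.\<close>

lemma stat_toggle_add_corner:
  assumes f: "f \<in> rpp S"
  shows "stat E (insert (a, b) S) (toggle a b (add_corner a b t f))
    = (E (int b - int a + 1) - E (int b - int a)) * int t
      + stat (E \<circ> transpose (int b - int a) (int b - int a + 1)) S f"
proof -
  define c where "c = int b - int a"
  define w where "w k = E (k + 1) - E k" for k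
  define E' where "E' = E \<circ> transpose c (c + 1)"
  define w' where "w' k = E' (k + 1) - E' k" for k
  define h where "h = toggle a b (add_corner a b t f)"
  define ct where "ct = (\<lambda>u. int (snd u) - int (fst u) :: int)"
  let ?D = "diag_below a b"
  let ?N = "{u \<in> S. ct u = c + 1}" and ?W = "{u \<in> S. ct u = c - 1}"
  have D: "?D = {u \<in> S. ct u = c}"
    by (auto simp: diag_below_def ct_def c_def diag_mem_iff)
  have w': "w' k = w k + (if k = c + 1 \<or> k = c - 1 then w c else 0) - (if k = c then 2 * w c else 0)" for k
    by (auto simp: w'_def w_def E'_def transpose_def)
  have hf: "h u = f u" if "u \<in> S" "ct u \<noteq> c" for u
    using that notin D by (auto simp: h_def toggle_def add_corner_def)
  have key: "(\<Sum>u \<in> insert (a, b) ?D. int (h u)) + (\<Sum>u \<in> ?D. int (f u))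
      = int t + (\<Sum>u \<in> ?N. int (f u)) + (\<Sum>u \<in> ?W. int (f u))"
  proof -
    have "{(i, j). (i, j) \<in> S \<and> Suc i + b = j + a} = ?N" "{(i, j). (i, j) \<in> S \<and> i + b = Suc j + a} = ?W"
      by (auto simp: ct_def c_def)
    then show ?thesis
      using arg_cong[OF toggle_add_corner_sum[OF f, of t], of int] by (simp add: h_def case_prod_unfold)
  qed
  have "stat E (insert (a, b) S) h = w c * int (h (a, b)) + (\<Sum>u \<in> S. w (ct u) * int (h u))"
    using fin notin by (simp add: stat_def w_def ct_def c_def case_prod_unfold)
  also have "(\<Sum>u \<in> S. w (ct u) * int (h u))
      = (\<Sum>u \<in> S. w (ct u) * int (f u) + (if ct u = c then w c * (int (h u) - int (f u)) else 0))"
    by (rule sum.cong) (auto simp: hf algebra_simps)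
  also have "\<dots> = (\<Sum>u \<in> S. w (ct u) * int (f u)) + w c * ((\<Sum>u \<in> ?D. int (h u)) - (\<Sum>u \<in> ?D. int (f u)))"
    by (simp only: D sum.distrib sum_if_const_mult[OF fin] sum_subtractf)
  finally have 1: "stat E (insert (a, b) S) h = (\<Sum>u \<in> S. w (ct u) * int (f u))
      + w c * ((\<Sum>u \<in> insert (a, b) ?D. int (h u)) - (\<Sum>u \<in> ?D. int (f u)))"
    using finite_diag corner_notin_diag by (simp add: algebra_simps)
  have "stat E' S f = (\<Sum>u \<in> S. w' (ct u) * int (f u))"
    by (simp add: stat_def w'_def ct_def case_prod_unfold)
  also have "\<dots> = (\<Sum>u \<in> S. w (ct u) * int (f u) + (if ct u = c + 1 then w c * int (f u) else 0)
      + (if ct u = c - 1 then w c * int (f u) else 0) - (if ct u = c then 2 * w c * int (f u) else 0))"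
    by (rule sum.cong) (auto simp: w' algebra_simps)
  also have "\<dots> = (\<Sum>u \<in> S. w (ct u) * int (f u)) + w c * (\<Sum>u \<in> ?N. int (f u))
      + w c * (\<Sum>u \<in> ?W. int (f u)) - 2 * w c * (\<Sum>u \<in> ?D. int (f u))"
    by (simp only: D sum.distrib sum_if_const_mult[OF fin] sum_subtractf)
  finally have 2: "stat E' S f = \<dots>" .
  have "stat E (insert (a, b) S) h = w c * int t + stat E' S f"
    unfolding 1 2 using arg_cong[OF key, of "(*) (w c)"] by (simp only: algebra_simps)
  then show ?thesis by (simp add: h_def w_def E'_def c_def)
qed

section \<open>Hooks when a corner is added\<close>

lemma finite_row: "finite {j. (i, j) \<in> S}"
  using finite_imageI[OF fin, of snd] by (rule rev_finite_subset) force

lemma finite_col: "finite {i. (i, j) \<in> S}"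
  using finite_imageI[OF fin, of fst] by (rule rev_finite_subset) force

lemma row_col_len_corner: "row_len S a = b" "col_len S b = a"
proof -
  have "{j. (a, j) \<in> S} = {..<b}" "{i. (i, b) \<in> S} = {..<a}"
    using below not_above by (auto simp: linorder_not_le[symmetric])
  then show "row_len S a = b" "col_len S b = a" by (simp_all add: row_len_def col_len_def)
qed

lemma row_len_insert: "row_len (insert (a, b) S) i = row_len S i + (if i = a then 1 else 0)"
proof -
  have "{j. (i, j) \<in> insert (a, b) S} = (if i = a then insert b {j. (i, j) \<in> S} else {j. (i, j) \<in> S})"
    by auto
  then show ?thesis using finite_row notin by (auto simp: row_len_def)
qed

lemma col_len_insert: "col_len (insert (a, b) S) j = col_len S j + (if j = b then 1 else 0)"
proof -
  have "{i. (i, j) \<in> insert (a, b) S} = (if j = b then insert a {i. (i, j) \<in> S} else {i. (i, j) \<in> S})"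
    by auto
  then show ?thesis using finite_col notin by (auto simp: col_len_def)
qed

lemma row_len_other:
  shows "i < a \<Longrightarrow> row_len S i > b" "a < i \<Longrightarrow> row_len S i \<le> b"
proof -
  assume "i < a"
  then have "{..b} \<subseteq> {j. (i, j) \<in> S}" using below by auto
  from card_mono[OF finite_row this] show "row_len S i > b" by (simp add: row_len_def)
next
  assume "a < i"
  then have "{j. (i, j) \<in> S} \<subseteq> {..<b}" using not_above[of i] by (auto simp: not_less[symmetric])
  from card_mono[OF _ this] show "row_len S i \<le> b" by (simp add: row_len_def)
qed

lemma col_len_other:
  shows "j < b \<Longrightarrow> col_len S j > a" "b < j \<Longrightarrow> col_len S j \<le> a"
proof -
  assume "j < b"
  then have "{..a} \<subseteq> {i. (i, j) \<in> S}" using below by auto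
  from card_mono[OF finite_col this] show "col_len S j > a" by (simp add: col_len_def)
next
  assume "b < j"
  then have "{i. (i, j) \<in> S} \<subseteq> {..<a}" using not_above[of _ j] by (auto simp: not_less[symmetric])
  from card_mono[OF _ this] show "col_len S j \<le> a" by (simp add: col_len_def)
qed

text \<open>By the bounds on the other rows, \<open>row_len S i - i\<close> is \<open>c\<close> for
  \<open>i = a\<close> and otherwise avoids \<open>c\<close> and \<open>c + 1\<close>; likewise
  \<open>j + 1 - col_len S j\<close> is \<open>c + 1\<close> for \<open>j = b\<close> and otherwise
  avoids both. The new corner turns this \<open>c\<close> into \<open>c + 1\<close> and this
  \<open>c + 1\<close> into \<open>c\<close>, which is what the transposition does.\<close>

lemma hook_stat_insert:
  "hook_stat E (insert (a, b) S) g
    = (E (int b - int a + 1) - E (int b - int a)) * int (g (a, b))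
      + hook_stat (E \<circ> transpose (int b - int a) (int b - int a + 1)) S g"
proof -
  define c where "c = int b - int a"
  have r: "transpose c (c + 1) (int (row_len S i) - int i) = int (row_len (insert (a, b) S) i) - int i" for i
    using row_len_other[of i] row_col_len_corner
    by (cases i a rule: linorder_cases) (auto simp: row_len_insert c_def transpose_def)
  have k: "transpose c (c + 1) (int j + 1 - int (col_len S j)) = int j + 1 - int (col_len (insert (a, b) S) j)" for j
    using col_len_other[of j] row_col_len_corner
    by (cases j b rule: linorder_cases) (auto simp: col_len_insert c_def transpose_def)
  have "hook_stat (E \<circ> transpose c (c + 1)) S g = (\<Sum>(i, j) \<in> S.
     (E (int (row_len (insert (a, b) S) i) - int i) - E (int j + 1 - int (col_len (insert (a, b) S) j))) * int (g (i, j)))"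
    by (simp add: hook_stat_def r k)
  then show ?thesis
    using fin notin row_col_len_corner
    by (simp add: hook_stat_def c_def row_len_insert col_len_insert algebra_simps)
qed

end

text \<open>Induction that removes a corner. The weights are arbitrary because the step for
  \<open>E\<close> uses the induction hypothesis for \<open>E\<close> composed with a transposition,
  which does not preserve constant weights.\<close>

lemma hook_bijection:
  assumes "finite S" "downset S"
  shows "\<exists>\<Phi>. bij_betw \<Phi> (fillings S) (rpp S) \<and> (\<forall>E. \<forall>g \<in> fillings S. stat E S (\<Phi> g) = hook_stat E S g)"
  using assms
proof (induction "card S" arbitrary: S)
  case 0
  then have [simp]: "S = {}" by simp
  show ?case
    by (rule exI[of _ id]) (auto simp: bij_betw_def rpp_def fillings_def stat_def hook_stat_def)
next
  case (Suc n S')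
  have "S' \<noteq> {}" using Suc.hyps(2) by auto
  \<comment> \<open>A cell with the largest \<open>i + j\<close> has no other cell to its
    south-east, so removing it leaves a diagram.\<close>
  then obtain a b where ab: "(a, b) \<in> S'" and mx: "\<And>i j. (i, j) \<in> S' \<Longrightarrow> i + j \<le> a + b"
  proof -
    have "finite ((\<lambda>(i, j). i + j) ` S')" using Suc.prems by simp
    from Max_in[OF this] Max_ge[OF this] \<open>S' \<noteq> {}\<close> show ?thesis
      by (force intro: that)
  qed
  define S where "S = S' - {(a, b)}"
  have S': "S' = insert (a, b) S" using ab by (auto simp: S_def)
  have dn: "downset S"
    unfolding downset_def S_def
  proof (intro allI impI, elim DiffE)
    fix i j i' j' assume h: "(i', j') \<in> S'" "(i', j') \<notin> {(a, b)}" "i \<le> i'" "j \<le> j'"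
    then have "(i, j) \<in> S'" using Suc.prems unfolding downset_def by blast
    moreover have "(i, j) \<noteq> (a, b)" using mx[OF h(1)] h by auto
    ultimately show "(i, j) \<in> S' - {(a, b)}" by simp
  qed
  interpret corner S a b
    using dn Suc.prems by unfold_locales (simp_all add: S'[symmetric], simp_all add: S_def)
  have "card S = n" using Suc.hyps(2) fin notin by (simp add: S')
  from Suc.hyps(1)[OF this[symmetric] fin dn] obtain \<Phi> where
    \<Phi>: "bij_betw \<Phi> (fillings S) (rpp S)"
    and st: "\<And>E g. g \<in> fillings S \<Longrightarrow> stat E S (\<Phi> g) = hook_stat E S g" by blast
  define sp where "sp = (\<lambda>g. (g (a, b), g((a, b) := 0)) :: nat \<times> (nat \<times> nat \<Rightarrow> nat))"
  have sp: "bij_betw sp (fillings S') (UNIV \<times> fillings S)"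
    by (rule bij_betw_byWitness[where f' = "\<lambda>(t, g). g((a, b) := t)"])
       (use notin in \<open>auto simp: sp_def fillings_def S' fun_eq_iff\<close>)
  have mp: "bij_betw (map_prod id \<Phi>) (UNIV \<times> fillings S) (UNIV \<times> rpp S)"
    unfolding bij_betw_def
  proof
    show "inj_on (map_prod id \<Phi>) (UNIV \<times> fillings S)"
      by (rule map_prod_inj_on) (use \<Phi> in \<open>auto simp: bij_betw_def\<close>)
    show "map_prod id \<Phi> ` (UNIV \<times> fillings S) = UNIV \<times> rpp S"
      using \<Phi> by (simp add: bij_betw_def map_prod_surj_on)
  qed
  \<comment> \<open>The corner entry of the filling becomes the excess \<open>t\<close>; the other
    entries pass through \<open>\<Phi>\<close> first, and the toggles come last.\<close>
  define \<Psi> where "\<Psi> = toggle a b \<circ> ((\<lambda>(t, f). add_corner a b t f) \<circ> (map_prod id \<Phi> \<circ> sp))"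
  have "bij_betw \<Psi> (fillings S') (rpp S')"
    unfolding \<Psi>_def
    using bij_betw_trans[OF bij_betw_trans[OF bij_betw_trans[OF sp mp] bij_add_corner] bij_toggle]
    by (simp add: S')
  moreover have "stat E S' (\<Psi> g) = hook_stat E S' g" if g: "g \<in> fillings S'" for E g
  proof -
    let ?E = "E \<circ> transpose (int b - int a) (int b - int a + 1)"
    have g0: "g((a, b) := 0) \<in> fillings S" using g by (auto simp: fillings_def S')
    then have "\<Phi> (g((a, b) := 0)) \<in> rpp S" using \<Phi> by (auto simp: bij_betw_def)
    moreover have "hook_stat ?E S (g((a, b) := 0)) = hook_stat ?E S g"
      unfolding hook_stat_def by (rule sum.cong) (use notin in auto)
    ultimately show ?thesis
      using hook_stat_insert[of E g] st[OF g0]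
      by (simp add: \<Psi>_def sp_def S' stat_toggle_add_corner)
  qed
  ultimately show ?case by blast
qed

section \<open>Generating functions\<close>

text \<open>These are partitions of \<open>n\<close> with one kind of part, of size
  \<open>h u\<close>, for each \<open>u\<close>; \<open>g u\<close> is its multiplicity.\<close>

definition weighted_fillings :: "('a \<Rightarrow> nat) \<Rightarrow> 'a set \<Rightarrow> nat \<Rightarrow> ('a \<Rightarrow> nat) set" where
  "weighted_fillings h S n = {g \<in> fillings S. (\<Sum>u \<in> S. h u * g u) = n}"

text \<open>Either the part \<open>h p\<close> does not occur or one copy of it can be taken away.
  On cardinalities this is the recursion for multiplication by
  \<open>1 / (1 - q ^ h p)\<close>.\<close>

lemma weighted_fillings_insert:
  assumes "finite S" "p \<notin> S" "0 < h p"
  shows "weighted_fillings h (insert p S) n = weighted_fillings h S n \<union>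
    (if h p \<le> n then (\<lambda>g. g(p := Suc (g p))) ` weighted_fillings h (insert p S) (n - h p) else {})"
    (is "?L = ?A \<union> ?B")
proof -
  have same: "(\<Sum>u \<in> S. h u * (g(p := v)) u) = (\<Sum>u \<in> S. h u * g u)" for g v
    by (rule sum.cong) (use assms in auto)
  have "?A \<subseteq> ?L" using assms by (auto simp: weighted_fillings_def fillings_def)
  moreover have "?B \<subseteq> ?L"
    using assms by (auto simp: weighted_fillings_def fillings_def same[simplified])
  moreover have "g \<in> ?A \<union> ?B" if g: "g \<in> ?L" for g
  proof (cases "g p")
    case 0
    have "g u = 0" if "u \<notin> S" for u
      using g 0 that by (cases "u = p") (auto simp: weighted_fillings_def fillings_def)
    then show ?thesis using g assms 0 by (simp add: weighted_fillings_def fillings_def)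
  next
    case (Suc k)
    have "h p \<le> n" using g assms Suc by (auto simp: weighted_fillings_def)
    moreover have "g(p := k) \<in> weighted_fillings h (insert p S) (n - h p)"
      using g assms Suc by (auto simp: weighted_fillings_def fillings_def same[simplified])
    moreover have "g = (g(p := k))(p := Suc ((g(p := k)) p))" using Suc by (auto simp: fun_eq_iff)
    ultimately have "h p \<le> n" "g \<in> (\<lambda>g. g(p := Suc (g p))) ` weighted_fillings h (insert p S) (n - h p)"
      by - (assumption, rule image_eqI)
    then show ?thesis by simp
  qed
  ultimately show ?thesis by blast
qed

lemma finite_weighted_fillings:
  assumes "finite S" "\<And>u. u \<in> S \<Longrightarrow> 0 < h u"
  shows "finite (weighted_fillings h S n)"
  using assms
proof (induction S arbitrary: n rule: finite_induct)
  case empty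
  have "weighted_fillings h {} n \<subseteq> {\<lambda>_. 0}" by (auto simp: weighted_fillings_def fillings_def)
  then show ?case by (rule finite_subset) simp
next
  case (insert p S)
  show ?case
  \<comment> \<open>An inner induction on \<open>n\<close>, since the recursion leads back to the
    same index set with the smaller total \<open>n - h p\<close>.\<close>
  proof (induction n rule: less_induct)
    case (less n)
    have p: "0 < h p" using insert.prems by simp
    have "finite (weighted_fillings h (insert p S) (n - h p))" if "h p \<le> n"
      using less that p by simp
    then show ?case
      using insert.IH insert.prems weighted_fillings_insert[of S p h n, OF insert.hyps p] by simp
  qed
qed

lemma card_weighted_fillings_insert:
  assumes "finite S" "p \<notin> S" "\<And>u. u \<in> insert p S \<Longrightarrow> 0 < h u"
  shows "card (weighted_fillings h (insert p S) n) = card (weighted_fillings h S n)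
    + (if h p \<le> n then card (weighted_fillings h (insert p S) (n - h p)) else 0)"
proof -
  let ?f = "\<lambda>g. g(p := Suc (g p))"
  have "inj ?f"
  proof (rule injI, rule ext)
    fix g g' u assume "?f g = ?f g'"
    from fun_cong[OF this, of u] show "g u = g' u" by (simp split: if_splits)
  qed
  then have inj: "inj_on ?f A" for A by (rule inj_on_subset) simp
  have disj: "weighted_fillings h S n \<inter> ?f ` A = {}" for A
    using assms by (auto simp: weighted_fillings_def fillings_def fun_eq_iff)
  have fin: "finite (weighted_fillings h S n)" "finite (weighted_fillings h (insert p S) m)" for m
    using assms by (auto intro!: finite_weighted_fillings)
  have "0 < h p" using assms(3) by simp
  from weighted_fillings_insert[of S p h n, OF assms(1,2) this] show ?thesis
    using fin by (auto simp: card_Un_disjoint[OF _ _ disj] card_image[OF inj])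
qed

lemma weighted_fillings_gf:
  assumes "finite S" "\<And>u. u \<in> S \<Longrightarrow> 0 < h u"
  shows "Abs_fps (\<lambda>n. of_nat (card (weighted_fillings h S n))) * (\<Prod>u \<in> S. 1 - fps_X ^ h u)
    = (1 :: 'a :: comm_ring_1 fps)"
  using assms
proof (induction S rule: finite_induct)
  case empty
  have "weighted_fillings h {} n = (if n = 0 then {\<lambda>_. 0} else {})" for n
    by (auto simp: weighted_fillings_def fillings_def)
  then show ?case by (auto simp: fps_eq_iff)
next
  case (insert p S)
  let ?F = "\<lambda>S. Abs_fps (\<lambda>n. of_nat (card (weighted_fillings h S n))) :: 'a fps"
  have "?F (insert p S) * (1 - fps_X ^ h p) = ?F S"
  proof (rule fps_ext)
    fix n
    have "card (weighted_fillings h (insert p S) n) = card (weighted_fillings h S n)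
      + (if n < h p then 0 else card (weighted_fillings h (insert p S) (n - h p)))"
      using card_weighted_fillings_insert[of S p h n] insert.hyps insert.prems by simp
    then show "fps_nth (?F (insert p S) * (1 - fps_X ^ h p)) n = fps_nth (?F S) n"
      by (simp add: right_diff_distrib fps_X_power_mult_right_nth)
  qed
  then show ?case using insert by (simp add: mult.assoc[symmetric])
qed

section \<open>The hook product formula\<close>

definition rpp_of :: "(nat \<times> nat) set \<Rightarrow> nat \<Rightarrow> (nat \<times> nat \<Rightarrow> nat) set" where
  "rpp_of S n = {f \<in> rpp S. sum f S = n}"

text \<open>Arm \<open>row_len S i - j - 1\<close> plus leg \<open>col_len S j - i - 1\<close> plus
  1; by \<open>hook_len_gt\<close> nothing is truncated on the cells of a diagram.\<close>

definition hook :: "(nat \<times> nat) set \<Rightarrow> nat \<times> nat \<Rightarrow> nat" where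
  "hook S = (\<lambda>(i, j). row_len S i + col_len S j - i - j - 1)"

lemma hook_len_gt:
  assumes "finite S" "downset S" "(i, j) \<in> S"
  shows "j < row_len S i" "i < col_len S j"
proof -
  have "finite {j. (i, j) \<in> S}" using finite_imageI[OF assms(1), of snd] by (rule rev_finite_subset) force
  moreover have "{..j} \<subseteq> {j. (i, j) \<in> S}" using assms by (auto simp: downset_def)
  ultimately have "card {..j} \<le> row_len S i" unfolding row_len_def by (rule card_mono)
  then show "j < row_len S i" by simp
  have "finite {i. (i, j) \<in> S}" using finite_imageI[OF assms(1), of fst] by (rule rev_finite_subset) force
  moreover have "{..i} \<subseteq> {i. (i, j) \<in> S}" using assms by (auto simp: downset_def)
  ultimately have "card {..i} \<le> col_len S j" unfolding col_len_def by (rule card_mono)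
  then show "i < col_len S j" by simp
qed

text \<open>For \<open>E = id\<close> every diagonal has weight 1, so \<open>stat\<close> is the sum
  of the entries, and the coefficient of each cell in \<open>hook_stat\<close> is its hook
  length.\<close>

lemma card_rpp_of:
  assumes S: "finite S" "downset S"
  shows "card (rpp_of S n) = card (weighted_fillings (hook S) S n)"
proof -
  obtain \<Phi> where \<Phi>: "bij_betw \<Phi> (fillings S) (rpp S)"
    and st: "\<And>g. g \<in> fillings S \<Longrightarrow> stat id S (\<Phi> g) = hook_stat id S g"
    using hook_bijection[OF S] by blast
  have "stat id S f = int (sum f S)" for f by (simp add: stat_def case_prod_unfold)
  moreover have "hook_stat id S g = int (\<Sum>u \<in> S. hook S u * g u)" for g
    unfolding hook_stat_def int_sum
  proof (rule sum.cong)
    fix u assume "u \<in> S"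
    moreover obtain i j where u: "u = (i, j)" by (cases u)
    ultimately have "int (row_len S i) - int i - (int j + 1 - int (col_len S j)) = int (hook S u)"
      using hook_len_gt[OF S, of i j] by (auto simp: hook_def)
    then show "(case u of (i, j) \<Rightarrow> (id (int (row_len S i) - int i) - id (int j + 1 - int (col_len S j)))
        * int (g (i, j))) = int (hook S u * g u)" by (simp add: u)
  qed simp
  ultimately have "sum (\<Phi> g) S = (\<Sum>u \<in> S. hook S u * g u)" if "g \<in> fillings S" for g
    using st[OF that] by (metis of_nat_eq_iff)
  moreover have "rpp S = \<Phi> ` fillings S" using \<Phi> by (simp add: bij_betw_def)
  ultimately have "rpp_of S n = \<Phi> ` weighted_fillings (hook S) S n"
    by (auto simp: rpp_of_def weighted_fillings_def)
  moreover have "inj_on \<Phi> (weighted_fillings (hook S) S n)"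
    by (rule inj_on_subset[of _ "fillings S"]) (use \<Phi> in \<open>auto simp: bij_betw_def weighted_fillings_def\<close>)
  ultimately show ?thesis by (simp add: card_image)
qed

text \<open>Stanley's hook formula with the denominators cleared.\<close>

lemma rpp_gf:
  assumes S: "finite S" "downset S"
  shows "Abs_fps (\<lambda>n. of_nat (card (rpp_of S n))) * (\<Prod>u \<in> S. 1 - fps_X ^ hook S u)
    = (1 :: 'a :: comm_ring_1 fps)"
proof -
  have "0 < hook S u" if "u \<in> S" for u
    using that hook_len_gt[OF S] by (cases u) (force simp: hook_def)
  then show ?thesis unfolding card_rpp_of[OF S] by (rule weighted_fillings_gf[OF S(1)])
qed

section \<open>The square with and without its last corner\<close>

abbreviation box :: "nat \<Rightarrow> (nat \<times> nat) set" where
  "box N \<equiv> {..N} \<times> {..N}"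

lemma hook_box:
  assumes "i \<le> N" "j \<le> N"
  shows "hook (box N) (i, j) = Suc (N - i + (N - j))"
proof -
  have "{j. (i, j) \<in> box N} = {..N}" "{i. (i, j) \<in> box N} = {..N}" using assms by auto
  then show ?thesis using assms by (simp add: hook_def row_len_def col_len_def)
qed

lemma hook_punctured_box:
  assumes "i \<le> N" "j \<le> N" "(i, j) \<noteq> (N, N)"
  shows "hook (box N - {(N, N)}) (i, j)
    = (if i = N then N - j else if j = N then N - i else Suc (N - i + (N - j)))"
proof -
  have "{j. (i, j) \<in> box N - {(N, N)}} = (if i = N then {..<N} else {..N})"
    "{i. (i, j) \<in> box N - {(N, N)}} = (if j = N then {..<N} else {..N})" using assms by auto
  then show ?thesis using assms by (auto simp: hook_def row_len_def col_len_def)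
qed

text \<open>\<open>F\<close> is arbitrary because the splitting serves the hooks of both shapes,
  which agree on the inner square and differ on the last column and row.\<close>

lemma prod_punctured_box:
  "(\<Prod>u \<in> box N - {(N, N)}. F u)
    = (\<Prod>u \<in> {..<N} \<times> {..<N}. F u) * (\<Prod>i<N. F (i, N)) * (\<Prod>j<N. F (N, j) :: 'a :: comm_monoid_mult)"
proof -
  have "box N - {(N, N)} = {..<N} \<times> {..<N} \<union> (\<lambda>i. (i, N)) ` {..<N} \<union> Pair N ` {..<N}"
    by auto
  moreover have "prod F ({..<N} \<times> {..<N} \<union> (\<lambda>i. (i, N)) ` {..<N} \<union> Pair N ` {..<N})
    = prod F ({..<N} \<times> {..<N}) * prod F ((\<lambda>i. (i, N)) ` {..<N}) * prod F (Pair N ` {..<N})"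
    by (subst prod.union_disjoint; (subst prod.union_disjoint)?) auto
  ultimately show ?thesis by (simp add: prod.reindex inj_on_def)
qed

text \<open>Both sides are \<open>p 1 * ... * p (N + 1)\<close>: lowering every index by one trades
  the factor \<open>p (N + 1)\<close> for \<open>p 1\<close>.\<close>

lemma prod_shift:
  fixes p :: "nat \<Rightarrow> 'a :: comm_monoid_mult"
  shows "(\<Prod>i<N. p (Suc (N - i))) * p 1 = (\<Prod>i<N. p (N - i)) * p (Suc N)"
proof -
  have "(\<Prod>i<N. p (N - i)) = (\<Prod>i<N. p (Suc (N - Suc i)))"
    by (rule prod.cong) (auto simp: Suc_diff_Suc)
  also have "\<dots> = (\<Prod>i<N. p (Suc i))" by (rule prod.nat_diff_reindex)
  finally have 1: "(\<Prod>i<N. p (N - i)) * p (Suc N) = (\<Prod>i<Suc N. p (Suc i))" by simp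
  have "(\<Prod>i<N. p (Suc (N - i))) = (\<Prod>i<N. p (Suc (Suc (N - Suc i))))"
    by (rule prod.cong) (auto simp: Suc_diff_Suc)
  also have "\<dots> = (\<Prod>i<N. p (Suc (Suc i)))" by (rule prod.nat_diff_reindex)
  finally show ?thesis unfolding 1 prod.lessThan_Suc_shift by (simp add: mult.commute)
qed

lemma punctured_box_gf:
  "Abs_fps (\<lambda>n. of_nat (card (rpp_of (box N - {(N, N)}) n))) * (1 - fps_X :: 'a :: comm_ring_1 fps)
    = Abs_fps (\<lambda>n. of_nat (card (rpp_of (box N) n))) * (1 - fps_X ^ Suc N)\<^sup>2"
  (is "?G' * _ = ?G * _")
proof -
  define p where "p = (\<lambda>m. 1 - fps_X ^ m :: 'a fps)"
  let ?H = "\<Prod>u \<in> box N. p (hook (box N) u)"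
  let ?H' = "\<Prod>u \<in> box N - {(N, N)}. p (hook (box N - {(N, N)}) u)"
  define A B I where "A = (\<Prod>i<N. p (Suc (N - i)))" and "B = (\<Prod>i<N. p (N - i))"
    and "I = (\<Prod>(i, j) \<in> {..<N} \<times> {..<N}. p (Suc (N - i + (N - j))))"
  have "?H = p (hook (box N) (N, N)) * (\<Prod>u \<in> box N - {(N, N)}. p (hook (box N) u))"
    by (rule prod.remove) auto
  also have "\<dots> = p 1 * (I * A * A)"
    unfolding prod_punctured_box I_def A_def
    by (intro arg_cong2[where f = "(*)"] prod.cong) (auto simp: hook_box)
  \<comment> \<open>The extra \<open>p 1\<close> provides one such factor for each of the two
    \<open>A\<close>, as \<open>prod_shift\<close> requires.\<close>
  finally have H: "?H * p 1 = I * (A * p 1) * (A * p 1)" by (simp add: mult_ac)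
  have "?H' = I * B * B"
    unfolding prod_punctured_box I_def B_def
    by (intro arg_cong2[where f = "(*)"] prod.cong) (auto simp: hook_punctured_box)
  moreover have "A * p 1 = B * p (Suc N)" unfolding A_def B_def by (rule prod_shift)
  ultimately have HH: "?H * p 1 = ?H' * (p (Suc N))\<^sup>2"
    unfolding H by (simp add: power2_eq_square mult_ac)
  have inv: "?G * ?H = 1" "?G' * ?H' = 1"
    unfolding p_def by (rule rpp_gf; auto simp: downset_def)+
  \<comment> \<open>Cancellation without division: the factor 1 enters as \<open>?G * ?H\<close> and
    leaves as \<open>?G' * ?H'\<close>.\<close>
  have "?G' * p 1 = ?G' * p 1 * (?G * ?H)" unfolding inv by simp
  also have "\<dots> = ?G * ?G' * (?H * p 1)" by (simp only: mult_ac)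
  also have "\<dots> = ?G * (p (Suc N))\<^sup>2 * (?G' * ?H')" unfolding HH by (simp only: mult_ac)
  finally have "?G' * p 1 = ?G * (p (Suc N))\<^sup>2" unfolding inv by simp
  then show ?thesis by (simp add: p_def)
qed

lemma punctured_box_coeff:
  assumes "n \<le> N"
  shows "fps_nth (Abs_fps (\<lambda>n. of_nat (card (rpp_of (box N - {(N, N)}) n))) * (1 - fps_X :: 'a :: comm_ring_1 fps)) n
    = of_nat (card (rpp_of (box N) n))"
proof -
  let ?G = "Abs_fps (\<lambda>n. of_nat (card (rpp_of (box N) n))) :: 'a fps"
  \<comment> \<open>With \<open>q\<close> equal to \<open>fps_X ^ Suc N\<close>, the error term ends
    in a factor \<open>q\<close> and has no coefficient of index at most \<open>N\<close>.\<close>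
  have expand: "g * (1 - q)\<^sup>2 = g - g * (2 - q) * q" for g q :: "'a fps"
    by (simp add: power2_eq_square algebra_simps)
  show ?thesis
    unfolding punctured_box_gf expand fps_sub_nth fps_X_power_mult_right_nth using assms by simp
qed

section \<open>Array partitions as reverse plane partitions\<close>

text \<open>The path goes down column \<open>j\<close> to row \<open>i'\<close> and then along that
  row; it stays in \<open>S\<close> because \<open>S\<close> is a diagram.\<close>

lemma rpp_mono:
  assumes f: "f \<in> rpp S" and S: "downset S" and "(i', j') \<in> S" "i \<le> i'" "j \<le> j'"
  shows "f (i, j) \<le> f (i', j')"
proof -
  have mem: "(k, l) \<in> S" if "k \<le> i'" "l \<le> j'" for k l
    using S assms(3) that unfolding downset_def by blast
  have "f (i, j) \<le> f (k, j)" if "i \<le> k" "k \<le> i'" for k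
    using that
  proof (induction k rule: dec_induct)
    case (step k)
    then show ?case using f mem[of "Suc k" j] \<open>j \<le> j'\<close> by (force simp: rpp_def intro: order_trans)
  qed simp
  moreover have "f (i', j) \<le> f (i', l)" if "j \<le> l" "l \<le> j'" for l
    using that
  proof (induction l rule: dec_induct)
    case (step l)
    then show ?case using f mem[of i' "Suc l"] by (force simp: rpp_def intro: order_trans)
  qed simp
  ultimately show ?thesis using assms by (meson order_refl order_trans)
qed

text \<open>A nonzero entry forces the \<open>a\<close> cells from \<open>(1, b)\<close> to
  \<open>(a, b)\<close> to be nonzero, each adding at least 1 to the total. The count starts at 1
  because \<open>(0, b)\<close> may be missing from \<open>I\<close>.\<close>

lemma array_partitions_support:
  assumes I: "\<And>i1 i2 j1 j2. (i1, i2) \<in> I \<Longrightarrow> i1 \<le> j1 \<Longrightarrow> i2 \<le> j2 \<Longrightarrow> (j1, j2) \<in> I"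
    and ax: "(1, 0) \<in> I" "(0, 1) \<in> I"
    and f: "f \<in> array_partitions I n" and ab: "(a, b) \<in> I" "f (a, b) \<noteq> 0"
  shows "a \<le> n" "b \<le> n"
proof -
  have fin: "finite {i \<in> I. f i \<noteq> 0}" and sm: "(\<Sum>i | i \<in> I \<and> f i \<noteq> 0. f i) = n"
    and mono: "\<And>i1 i2 j1 j2. (i1, i2) \<in> I \<Longrightarrow> (j1, j2) \<in> I \<Longrightarrow> i1 \<le> j1 \<Longrightarrow> i2 \<le> j2 \<Longrightarrow>
        f (j1, j2) \<le> f (i1, i2)"
    using f by (auto simp: array_partitions_def)
  have le: "card A \<le> n" if "A \<subseteq> {i \<in> I. f i \<noteq> 0}" for A
  proof -
    have "card A \<le> card {i \<in> I. f i \<noteq> 0}" using card_mono[OF fin that] .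
    also have "\<dots> = (\<Sum>i | i \<in> I \<and> f i \<noteq> 0. 1)" by simp
    also have "\<dots> \<le> (\<Sum>i | i \<in> I \<and> f i \<noteq> 0. f i)" by (rule sum_mono) auto
    finally show ?thesis using sm by simp
  qed
  have "(k, b) \<in> I \<and> f (k, b) \<noteq> 0" if "k \<in> {1..a}" for k
    using I[OF ax(1), of k b] mono[of k b a b] ab that by auto
  then have "card ((\<lambda>k. (k, b)) ` {1..a}) \<le> n" by (intro le) auto
  then show "a \<le> n" by (simp add: card_image inj_on_def)
  have "(a, k) \<in> I \<and> f (a, k) \<noteq> 0" if "k \<in> {1..b}" for k
    using I[OF ax(2), of a k] mono[of a k a b] ab that by auto
  then have "card (Pair a ` {1..b}) \<le> n" by (intro le) auto
  then show "b \<le> n" by (simp add: card_image inj_on_def)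
qed

text \<open>A half turn of the square makes the upward closed \<open>I\<close> a diagram and
  decreasing arrays increasing. As \<open>n \<le> N\<close>, no nonzero entry lies outside the
  square.\<close>

lemma card_array_partitions:
  assumes I: "\<And>i1 i2 j1 j2. (i1, i2) \<in> I \<Longrightarrow> i1 \<le> j1 \<Longrightarrow> i2 \<le> j2 \<Longrightarrow> (j1, j2) \<in> I"
    and ax: "(1, 0) \<in> I" "(0, 1) \<in> I" and N: "n \<le> N"
  shows "card (array_partitions I n) = card (rpp_of {(i, j). i \<le> N \<and> j \<le> N \<and> (N - i, N - j) \<in> I} n)"
proof -
  define S where "S = {(i, j). i \<le> N \<and> j \<le> N \<and> (N - i, N - j) \<in> I}"
  define fl where "fl = (\<lambda>(i, j). (N - i, N - j))"
  define rot where "rot = (\<lambda>f u. if u \<in> S then f (fl u) else 0 :: nat)"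
  \<comment> \<open>Two defaults: 0 on the part of \<open>I\<close> beyond the square, and
    \<open>undefined\<close> off \<open>I\<close>, as extensionality demands.\<close>
  define unrot where "unrot = (\<lambda>g u. if u \<in> I then if u \<in> box N then g (fl u) else 0 else undefined :: nat)"
  have fl_S: "fl u \<in> S \<longleftrightarrow> u \<in> I" "fl (fl u) = u" if "u \<in> box N" for u
    using that by (auto simp: S_def fl_def)
  have S_box: "u \<in> box N" "fl u \<in> I" "fl u \<in> box N" if "u \<in> S" for u
    using that by (auto simp: S_def fl_def)
  have dn: "downset S"
    unfolding downset_def S_def using I by (auto intro: I diff_le_mono2)
  have supp: "u \<in> box N" if "f \<in> array_partitions I n" "u \<in> I" "f u \<noteq> 0" for f u
  proof -
    obtain a b where u: "u = (a, b)" by (cases u)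
    have "a \<le> n" "b \<le> n"
      by (rule array_partitions_support[OF _ ax that(1)]; use that u in \<open>blast intro: I\<close>)+
    then show ?thesis using u N by simp
  qed
  have sum_eq: "(\<Sum>u | u \<in> I \<and> f u \<noteq> 0. f u) = (\<Sum>u \<in> S. f (fl u))"
    if "\<And>u. u \<in> I \<Longrightarrow> f u \<noteq> 0 \<Longrightarrow> u \<in> box N" for f :: "nat \<times> nat \<Rightarrow> nat"
  proof -
    have "(\<Sum>u | u \<in> I \<and> f u \<noteq> 0. f u) = (\<Sum>u \<in> I \<inter> box N. f u)"
      by (rule sum.mono_neutral_left) (use that in auto)
    also have "\<dots> = (\<Sum>u \<in> S. f (fl u))"
      by (rule sum.reindex_bij_witness[where i = fl and j = fl]) (use fl_S S_box in auto)
    finally show ?thesis .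
  qed
  have "bij_betw rot (array_partitions I n) (rpp_of S n)"
  proof (rule bij_betw_byWitness[where f' = unrot])
    show "\<forall>f \<in> array_partitions I n. unrot (rot f) = f"
    proof (intro ballI ext)
      fix f u assume f: "f \<in> array_partitions I n"
      then have "f \<in> extensional I" by (auto simp: array_partitions_def PiE_def)
      then show "unrot (rot f) u = f u"
        using supp[OF f, of u] fl_S[of u] by (cases u) (auto simp: unrot_def rot_def extensional_def)
    qed
    show "\<forall>g \<in> rpp_of S n. rot (unrot g) = g"
      using S_box fl_S by (auto simp: unrot_def rot_def fun_eq_iff rpp_of_def rpp_def fillings_def)
    show "rot ` array_partitions I n \<subseteq> rpp_of S n"
    proof clarify
      fix f assume f: "f \<in> array_partitions I n"
      then have mono: "\<And>i1 i2 j1 j2. (i1, i2) \<in> I \<Longrightarrow> (j1, j2) \<in> I \<Longrightarrow> i1 \<le> j1 \<Longrightarrow> i2 \<le> j2 \<Longrightarrow>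
        f (j1, j2) \<le> f (i1, i2)" by (auto simp: array_partitions_def)
      have "sum (rot f) S = (\<Sum>u \<in> S. f (fl u))" by (simp add: rot_def)
      then have "sum (rot f) S = n"
        using sum_eq[of f, OF supp[OF f]] f by (simp add: array_partitions_def)
      moreover have "rot f (i, j) \<le> rot f (Suc i, j)" if "(Suc i, j) \<in> S" for i j
      proof -
        have "(i, j) \<in> S" using that dn unfolding downset_def by (meson le_SucI order_refl)
        with that show ?thesis by (auto simp: rot_def fl_def S_def intro!: mono)
      qed
      moreover have "rot f (i, j) \<le> rot f (i, Suc j)" if "(i, Suc j) \<in> S" for i j
      proof -
        have "(i, j) \<in> S" using that dn unfolding downset_def by (meson le_SucI order_refl)
        with that show ?thesis by (auto simp: rot_def fl_def S_def intro!: mono)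
      qed
      ultimately show "rot f \<in> rpp_of S n"
        by (auto simp: rpp_of_def rpp_def fillings_def rot_def)
    qed
    show "unrot ` rpp_of S n \<subseteq> array_partitions I n"
    proof clarify
      fix g assume g: "g \<in> rpp_of S n"
      have box: "u \<in> box N" if "u \<in> I" "unrot g u \<noteq> 0" for u
        using that by (auto simp: unrot_def split: if_splits)
      have "finite {u \<in> I. unrot g u \<noteq> 0}"
        by (rule finite_subset[of _ "box N"]) (use box in auto)
      moreover have "(\<Sum>u | u \<in> I \<and> unrot g u \<noteq> 0. unrot g u) = n"
      proof -
        have "(\<Sum>u | u \<in> I \<and> unrot g u \<noteq> 0. unrot g u) = (\<Sum>u \<in> S. unrot g (fl u))"
          by (rule sum_eq) (rule box)
        also have "\<dots> = sum g S"
          by (rule sum.cong) (use S_box fl_S in \<open>auto simp: unrot_def\<close>)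
        finally show ?thesis using g by (simp add: rpp_of_def)
      qed
      moreover have "unrot g (j1, j2) \<le> unrot g (i1, i2)"
        if "(i1, i2) \<in> I" "(j1, j2) \<in> I" "i1 \<le> j1" "i2 \<le> j2" for i1 i2 j1 j2
      proof (cases "(j1, j2) \<in> box N")
        case True
        have "g (fl (j1, j2)) \<le> g (fl (i1, i2))"
          unfolding fl_def prod.case
          by (rule rpp_mono[of g S]) (use g dn that True in \<open>auto simp: rpp_of_def S_def\<close>)
        then show ?thesis using that True by (auto simp: unrot_def)
      next
        case False
        then show ?thesis using that by (auto simp: unrot_def)
      qed
      moreover have "unrot g \<in> I \<rightarrow>\<^sub>E UNIV" by (auto simp: unrot_def)
      ultimately show "unrot g \<in> array_partitions I n" by (auto simp: array_partitions_def)
    qed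
  qed
  then show ?thesis unfolding S_def by (rule bij_betw_same_card)
qed

section \<open>The two counting functions and their quotient\<close>

lemma P3_eq:
  assumes "n \<le> N"
  shows "P3 n = card (rpp_of (box N) n)"
proof -
  have "{(i, j). i \<le> N \<and> j \<le> N \<and> (N - i, N - j) \<in> UNIV} = box N" by auto
  then show ?thesis
    unfolding P3_def partitions3_def by (subst card_array_partitions[OF _ _ _ assms]) simp_all
qed

lemma punctual_P3_eq:
  assumes "n \<le> N"
  shows "punctual_P3 n = card (rpp_of (box N - {(N, N)}) n)"
proof -
  have "{(i, j). i \<le> N \<and> j \<le> N \<and> (N - i, N - j) \<in> UNIV - {(0, 0)}} = box N - {(N, N)}" by auto
  then show ?thesis
    unfolding punctual_P3_def punctual_partitions3_def
    by (subst card_array_partitions[OF _ _ _ assms]) fastforce+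
qed

theorem lemma7p5:
  "Abs_fps (\<lambda>n. of_nat (punctual_P3 n)) / Abs_fps (\<lambda>n. of_nat (P3 n))
     = (1 / (1 - fps_X) :: rat fps)"
proof -
  let ?P = "Abs_fps (\<lambda>n. of_nat (P3 n)) :: rat fps"
  let ?P' = "Abs_fps (\<lambda>n. of_nat (punctual_P3 n)) :: rat fps"
  have "fps_nth (?P' * (1 - fps_X)) n = fps_nth ?P n" for n
  proof -
    \<comment> \<open>The square may depend on the coefficient: index \<open>n\<close> involves only
      counts up to \<open>n\<close>, for which \<open>N = n\<close> is large enough.\<close>
    have "fps_nth (?P' * (1 - fps_X)) n
      = fps_nth (Abs_fps (\<lambda>m. of_nat (card (rpp_of (box n - {(n, n)}) m))) * (1 - fps_X)) n"
      unfolding fps_mult_nth by (rule sum.cong) (auto simp: punctual_P3_eq)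
    then show ?thesis by (simp add: punctured_box_coeff P3_eq[of n n])
  qed
  then have eq: "?P = ?P' * (1 - fps_X)" by (simp add: fps_eq_iff)
  \<comment> \<open>The zero array gives constant term 1, so the denominator is nonzero and can be
    cancelled.\<close>
  have "rpp_of (box 0) 0 = {\<lambda>_. 0}"
    by (auto simp: rpp_of_def rpp_def fillings_def fun_eq_iff) (metis gr0I)
  then have "fps_nth ?P 0 = 1" by (simp add: P3_eq[of 0 0])
  then have "?P \<noteq> 0" by (metis fps_zero_nth zero_neq_one)
  moreover have "?P' = 1 / (1 - fps_X) * ?P"
    unfolding eq by (simp add: fps_divide_unit inverse_mult_eq_1' mult_ac)
  ultimately show ?thesis by simp
qed

end
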